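(* Let $s\in(0,1)$, $p\in(1,\infty)$, and let $K\subset\mathbf{R}^d$ be compact. Equip $\mathrm{VMO}_K(\mathbf{R}^d)\cap\mathrm{W}^{s,p}(\mathbf{R}^d)$ with the graph norm $\|\cdot\|_{\mathrm{BMO}(\mathbf{R}^d)}+\|\cdot\|_{\mathrm{W}^{s,p}(\mathbf{R}^d)}$. Then the identity map $$\iota:\mathrm{VMO}_K(\mathbf{R}^d)\cap\mathrm{W}^{s,p}(\mathbf{R}^d)\hookrightarrow\mathrm{W}^{s,p}(\mathbf{R}^d)$$ is a continuous inclusion, and the extension of such a function by zero to all of $\mathbf{R}^d$ coincides with the function itself.
   Context: $\mathrm{VMO}(\mathbf{R}^d)$ is the closure of $\mathrm{C}_c(\mathbf{R}^d)$ in the norm $\|f\|_{\mathrm{BMO}}=\sup_B\frac1{|B|}\int_B|f-f_B|\,dx$ (sup over balls, $f_B$ the mean), and $\mathrm{VMO}_K(\mathbf{R}^d)=\{\varphi\in\mathrm{VMO}(\mathbf{R}^d):\operatorname{supp}\varphi\subseteq K\}$. $\mathrm{W}^{s,p}(\mathbf{R}^d)$ is the fractional Sobolev (Sobolev--Slobodeckij) space with the Gagliardo norm. "Extension by zero" means taking the restriction to $K$ and setting it to $0$ outside $K$. *)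

theory Defs
  imports "HOL-Analysis.Analysis"
begin

text \<open>
  The domain is an arbitrary Euclidean space \<open>'a\<close> of dimension \<open>d = DIM('a)\<close>.  The codomain is an
  arbitrary Euclidean space \<open>'b\<close>; in particular it may be \<open>real\<close> or \<open>complex\<close>.
\<close>

section \<open>Functions modulo equality almost everywhere\<close>

definition ae_eq :: "(('a::euclidean_space \<Rightarrow> 'b::euclidean_space) \<times> ('a \<Rightarrow> 'b)) set" where
  "ae_eq = {(f, g). f \<in> borel_measurable lebesgue \<and> g \<in> borel_measurable lebesgue \<and>
                    (AE x in lebesgue. f x = g x)}"

text \<open>
  Spaces are first introduced as sets of functions and then divided by \<^const>\<open>ae_eq\<close>.  All
  functionals \<open>N\<close> below take the same value on functions that agree almost everywhere, so the
  choice of representatives is immaterial.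
\<close>

definition class_dist ::
    "(('a::euclidean_space \<Rightarrow> 'b::euclidean_space) \<Rightarrow> real) \<Rightarrow> ('a \<Rightarrow> 'b) set \<Rightarrow> ('a \<Rightarrow> 'b) set \<Rightarrow> real"
  where "class_dist N F G = N (\<lambda>x. (SOME f. f \<in> F) x - (SOME g. g \<in> G) x)"

text \<open>The topology of the distance \<open>N (f - g)\<close> on the quotient of a function space \<open>X\<close>.\<close>

definition norm_topology ::
    "('a::euclidean_space \<Rightarrow> 'b::euclidean_space) set \<Rightarrow> (('a \<Rightarrow> 'b) \<Rightarrow> real) \<Rightarrow> ('a \<Rightarrow> 'b) set topology"
  where "norm_topology X N = Metric_space.mtopology (X // ae_eq) (class_dist N)"

section \<open>Bounded and vanishing mean oscillation\<close>

definition locally_integrable :: "('a::euclidean_space \<Rightarrow> 'b::euclidean_space) set" where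
  "locally_integrable = {f \<in> borel_measurable lebesgue.
     \<forall>C. compact C \<longrightarrow> set_integrable lebesgue C f}"

definition mean_on :: "'a set \<Rightarrow> ('a::euclidean_space \<Rightarrow> 'b::euclidean_space) \<Rightarrow> 'b" where
  "mean_on B f = (LINT x:B|lebesgue. f x) /\<^sub>R measure lebesgue B"

definition bmo_seminorm :: "('a::euclidean_space \<Rightarrow> 'b::euclidean_space) \<Rightarrow> ennreal" where
  "bmo_seminorm f = (SUP B\<in>{ball x r | x r. 0 < r}.
     (\<integral>\<^sup>+x\<in>B. ennreal (norm (f x - mean_on B f)) \<partial>lebesgue) / emeasure lebesgue B)"

definition BMO :: "('a::euclidean_space \<Rightarrow> 'b::euclidean_space) set" where
  "BMO = {f \<in> locally_integrable. bmo_seminorm f < \<infinity>}"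

definition bmo_norm :: "('a::euclidean_space \<Rightarrow> 'b::euclidean_space) \<Rightarrow> real" where
  "bmo_norm f = enn2real (bmo_seminorm f)"

definition Cc :: "('a::euclidean_space \<Rightarrow> 'b::euclidean_space) set" where
  "Cc = {g. continuous_on UNIV g \<and> compact (closure {x. g x \<noteq> 0})}"

definition VMO :: "('a::euclidean_space \<Rightarrow> 'b::euclidean_space) set" where
  "VMO = {f \<in> BMO. \<forall>\<epsilon>>0. \<exists>g\<in>Cc. bmo_seminorm (\<lambda>x. f x - g x) < ennreal \<epsilon>}"

text \<open>
  The support of a function that is only determined almost everywhere: the complement of the largest open set on which the
  function vanishes almost everywhere.
\<close>

definition ess_support :: "('a::euclidean_space \<Rightarrow> 'b::euclidean_space) \<Rightarrow> 'a set" where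
  "ess_support f = - \<Union>{U. open U \<and> (AE x in lebesgue. x \<in> U \<longrightarrow> f x = 0)}"

definition VMO_supported :: "'a set \<Rightarrow> ('a::euclidean_space \<Rightarrow> 'b::euclidean_space) set" where
  "VMO_supported K = {f \<in> VMO. ess_support f \<subseteq> K}"

section \<open>Sobolev--Slobodeckij spaces\<close>

text \<open>
  The \<open>p\<close>-th power of the Gagliardo norm.  On the diagonal the integrand is \<open>0 / 0 = 0\<close>, which is
  irrelevant because the diagonal is a null set.
\<close>

definition gagliardo_power ::
    "real \<Rightarrow> real \<Rightarrow> ('a::euclidean_space \<Rightarrow> 'b::euclidean_space) \<Rightarrow> ennreal" where
  "gagliardo_power s p f =
     (\<integral>\<^sup>+x. ennreal (norm (f x) powr p) \<partial>lebesgue) +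
     (\<integral>\<^sup>+x. (\<integral>\<^sup>+y. ennreal (norm (f x - f y) powr p / norm (x - y) powr (real DIM('a) + s * p))
        \<partial>lebesgue) \<partial>lebesgue)"

definition Wsp :: "real \<Rightarrow> real \<Rightarrow> ('a::euclidean_space \<Rightarrow> 'b::euclidean_space) set" where
  "Wsp s p = {f \<in> borel_measurable lebesgue. gagliardo_power s p f < \<infinity>}"

definition Wsp_norm ::
    "real \<Rightarrow> real \<Rightarrow> ('a::euclidean_space \<Rightarrow> 'b::euclidean_space) \<Rightarrow> real" where
  "Wsp_norm s p f = enn2real (gagliardo_power s p f) powr (1 / p)"

section \<open>The intersection space, its graph norm, and extension by zero\<close>

definition VMO_Wsp ::
    "'a set \<Rightarrow> real \<Rightarrow> real \<Rightarrow> ('a::euclidean_space \<Rightarrow> 'b::euclidean_space) set" where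
  "VMO_Wsp K s p = VMO_supported K \<inter> Wsp s p"

definition graph_norm ::
    "real \<Rightarrow> real \<Rightarrow> ('a::euclidean_space \<Rightarrow> 'b::euclidean_space) \<Rightarrow> real" where
  "graph_norm s p f = bmo_norm f + Wsp_norm s p f"

definition zero_extension :: "'a set \<Rightarrow> ('a \<Rightarrow> 'b::zero) \<Rightarrow> 'a \<Rightarrow> 'b" where
  "zero_extension K f = (\<lambda>x. if x \<in> K then f x else 0)"

end

theory Submission
  imports Defs
begin

text \<open>
  The graph norm dominates the Sobolev--Slobodeckij norm, so the inclusion is 1-Lipschitz; the work
  lies in checking that both norms induce metrics on the spaces of classes.  Minkowski's inequality
  for the Gagliardo norm is obtained from the convexity of its \<open>p\<close>-th power.  A function vanishes
  almost everywhere outside its essential support by the Lindelof property, whence the statement on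
  extension by zero.
\<close>

section \<open>Classes modulo equality almost everywhere\<close>

lemma ae_eqD:
  assumes "(f, g) \<in> ae_eq"
  shows "f \<in> borel_measurable lebesgue" "g \<in> borel_measurable lebesgue" "AE x in lebesgue. f x = g x"
  using assms by (auto simp: ae_eq_def)

lemma equiv_ae_eq:
  "equiv (borel_measurable lebesgue :: ('a::euclidean_space \<Rightarrow> 'b::euclidean_space) set) ae_eq"
    (is "equiv ?M ?R")
proof (rule equivI)
  show "?R \<subseteq> ?M \<times> ?M"
    by (auto simp: ae_eq_def)
  show "refl_on ?M ?R"
    by (auto simp: refl_on_def ae_eq_def)
  show "sym ?R"
    by (rule symI) (auto simp: ae_eq_def elim: eventually_mono)
  show "trans ?R"
  proof (rule transI)
    fix f g h :: "'a \<Rightarrow> 'b"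
    assume fg: "(f, g) \<in> ae_eq" and gh: "(g, h) \<in> ae_eq"
    have "AE x in lebesgue. f x = h x"
      using ae_eqD(3)[OF fg] ae_eqD(3)[OF gh] by eventually_elim simp
    then show "(f, h) \<in> ae_eq"
      using ae_eqD[OF fg] ae_eqD[OF gh] by (auto simp: ae_eq_def)
  qed
qed

text \<open>A union of full classes of measurable functions. Without this closure a class in the
  quotient of \<open>X\<close> could contain functions outside \<open>X\<close>, and the
  representative picked by \<open>SOME\<close> in \<open>class_dist\<close> could be one of
  them.\<close>

definition ae_saturated :: "('a::euclidean_space \<Rightarrow> 'b::euclidean_space) set \<Rightarrow> bool" where
  "ae_saturated X \<longleftrightarrow> X \<subseteq> borel_measurable lebesgue \<and> (\<forall>f g. f \<in> X \<longrightarrow> (f, g) \<in> ae_eq \<longrightarrow> g \<in> X)"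

lemma ae_saturatedD:
  assumes "ae_saturated X"
  shows "f \<in> X \<Longrightarrow> f \<in> borel_measurable lebesgue" "f \<in> X \<Longrightarrow> (f, g) \<in> ae_eq \<Longrightarrow> g \<in> X"
  using assms unfolding ae_saturated_def by blast+

text \<open>A class is nonempty because its generator is measurable and hence related to itself, so
  \<open>SOME\<close> picks a genuine member; saturation puts that member back into
  \<open>X\<close>.\<close>

lemma some_in_class:
  assumes X: "ae_saturated X" and F: "F \<in> X // ae_eq"
  shows "(SOME f. f \<in> F) \<in> X" "F = ae_eq `` {SOME f. f \<in> F}"
proof -
  obtain f0 where f0: "f0 \<in> X" "F = ae_eq `` {f0}"
    using F by (auto elim: quotientE)
  have "f0 \<in> borel_measurable lebesgue"
    using ae_saturatedD(1)[OF X f0(1)] .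
  then have "f0 \<in> F"
    unfolding f0(2) by (rule equiv_class_self[OF equiv_ae_eq])
  then have "(SOME f. f \<in> F) \<in> F"
    by (rule someI[of "\<lambda>f. f \<in> F"])
  then have *: "(f0, SOME f. f \<in> F) \<in> ae_eq"
    using f0 by auto
  then show "(SOME f. f \<in> F) \<in> X"
    by (rule ae_saturatedD(2)[OF X f0(1)])
  show "F = ae_eq `` {SOME f. f \<in> F}"
    by (rule trans[OF f0(2) equiv_class_eq[OF equiv_ae_eq *]])
qed

text \<open>Reduces the metric axioms on classes to properties of \<open>N\<close> on functions,
  evaluated at the chosen representatives. Nonnegativity and symmetry are asked of all functions
  because \<open>Metric_space\<close> asks them of all points, whereas separation and the triangle
  inequality concern only points of the carrier.\<close>

lemma Metric_space_quotient:
  fixes X :: "('a::euclidean_space \<Rightarrow> 'b::euclidean_space) set"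
  assumes X: "ae_saturated X"
    and nonneg: "\<And>f. 0 \<le> N f"
    and zero: "N (\<lambda>x. 0) = 0"
    and commute: "\<And>f g. N (\<lambda>x. f x - g x) = N (\<lambda>x. g x - f x)"
    and separated: "\<And>f g. f \<in> X \<Longrightarrow> g \<in> X \<Longrightarrow> N (\<lambda>x. f x - g x) = 0 \<Longrightarrow> AE x in lebesgue. f x = g x"
    and triangle: "\<And>f g h. f \<in> X \<Longrightarrow> g \<in> X \<Longrightarrow> h \<in> X \<Longrightarrow>
      N (\<lambda>x. f x - h x) \<le> N (\<lambda>x. f x - g x) + N (\<lambda>x. g x - h x)"
  shows "Metric_space (X // ae_eq) (class_dist N)"
proof
  fix F G :: "('a \<Rightarrow> 'b) set"
  show "0 \<le> class_dist N F G"
    by (simp add: class_dist_def nonneg)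
  show "class_dist N F G = class_dist N G F"
    unfolding class_dist_def by (rule commute)
  assume F: "F \<in> X // ae_eq" and G: "G \<in> X // ae_eq"
  note f = some_in_class[OF X F] and g = some_in_class[OF X G]
  show "class_dist N F G = 0 \<longleftrightarrow> F = G"
  proof
    assume "class_dist N F G = 0"
    then have "AE x in lebesgue. (SOME f. f \<in> F) x = (SOME g. g \<in> G) x"
      using separated f(1) g(1) by (simp add: class_dist_def)
    then have "((SOME f. f \<in> F), (SOME g. g \<in> G)) \<in> ae_eq"
      using ae_saturatedD(1)[OF X f(1)] ae_saturatedD(1)[OF X g(1)] by (simp add: ae_eq_def)
    from equiv_class_eq[OF equiv_ae_eq this] show "F = G"
      using f(2) g(2) by simp
  \<comment> \<open>For equal classes both choices are the same function, so \<open>N\<close> is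
    applied to the zero function.\<close>
  qed (simp add: class_dist_def zero)
  fix H :: "('a \<Rightarrow> 'b) set"
  assume H: "H \<in> X // ae_eq"
  show "class_dist N F H \<le> class_dist N F G + class_dist N G H"
    unfolding class_dist_def using triangle f(1) g(1) some_in_class(1)[OF X H] by blast
qed

section \<open>Mean oscillation\<close>

lemma mean_on_cong_AE:
  assumes "f \<in> borel_measurable lebesgue" "g \<in> borel_measurable lebesgue"
    and "AE x in lebesgue. f x = g x" "B \<in> sets lebesgue"
  shows "mean_on B f = mean_on B g"
  unfolding mean_on_def
  by (subst set_lebesgue_integral_cong_AE[of B lebesgue f g]) (use assms in auto)

lemma bmo_seminorm_cong_AE:
  assumes "f \<in> borel_measurable lebesgue" "g \<in> borel_measurable lebesgue"
    and ae: "AE x in lebesgue. f x = g x"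
  shows "bmo_seminorm f = bmo_seminorm g"
  unfolding bmo_seminorm_def
proof (rule SUP_cong[OF refl])
  fix B :: "'a set" assume "B \<in> {ball x r |x r. 0 < r}"
  then have "mean_on B f = mean_on B g"
    using assms by (intro mean_on_cong_AE) auto
  then have "(\<integral>\<^sup>+x\<in>B. ennreal (norm (f x - mean_on B f)) \<partial>lebesgue)
      = (\<integral>\<^sup>+x\<in>B. ennreal (norm (g x - mean_on B g)) \<partial>lebesgue)"
    using ae by (intro nn_integral_cong_AE) auto
  then show "(\<integral>\<^sup>+x\<in>B. ennreal (norm (f x - mean_on B f)) \<partial>lebesgue) / emeasure lebesgue B
      = (\<integral>\<^sup>+x\<in>B. ennreal (norm (g x - mean_on B g)) \<partial>lebesgue) / emeasure lebesgue B"
    by simp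
qed

lemma bmo_seminorm_zero: "bmo_seminorm (\<lambda>x. 0) = 0"
  unfolding bmo_seminorm_def
  by (intro antisym SUP_least) (auto simp: mean_on_def set_lebesgue_integral_def)

lemma bmo_seminorm_minus: "bmo_seminorm (\<lambda>x. - f x) = bmo_seminorm f"
proof -
  have "mean_on B (\<lambda>x. - f x) = - mean_on B f" for B
    by (simp add: mean_on_def set_lebesgue_integral_def)
  moreover have "norm (- f x - - m) = norm (f x - m)" for x m
    by (simp add: norm_minus_commute)
  ultimately show ?thesis
    by (simp only: bmo_seminorm_def)
qed

text \<open>Local integrability speaks of compact sets, while \<open>bmo_seminorm\<close> uses open
  balls; the closed ball mediates.\<close>

lemma locally_integrable_ball:
  assumes "f \<in> locally_integrable"
  shows "set_integrable lebesgue (ball x r) f"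
proof (rule set_integrable_subset)
  show "set_integrable lebesgue (cball x r) f"
    using assms by (auto simp: locally_integrable_def)
qed auto

text \<open>On each ball the mean is additive, so the triangle inequality holds pointwise for the
  deviations from the mean; it is then averaged over the ball and bounded by the two
  suprema.\<close>

lemma bmo_seminorm_add_le:
  assumes f: "f \<in> locally_integrable" and g: "g \<in> locally_integrable"
  shows "bmo_seminorm (\<lambda>x. f x + g x) \<le> bmo_seminorm f + bmo_seminorm g"
proof -
  have [measurable]: "f \<in> borel_measurable lebesgue" "g \<in> borel_measurable lebesgue"
    using f g by (auto simp: locally_integrable_def)
  define osc where "osc B h = (\<integral>\<^sup>+x\<in>B. ennreal (norm (h x - mean_on B h)) \<partial>lebesgue)"
    for B and h :: "'a \<Rightarrow> 'b"
  have "osc B (\<lambda>x. f x + g x) / emeasure lebesgue B \<le> bmo_seminorm f + bmo_seminorm g"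
    if "0 < r" and B: "B = ball x r" for B x r
  proof -
    have [measurable]: "B \<in> sets lebesgue"
      using B by simp
    \<comment> \<open>Additivity requires integrability of both functions on the ball, since a
      Bochner integral that does not exist defaults to 0.\<close>
    have mean: "mean_on B (\<lambda>x. f x + g x) = mean_on B f + mean_on B g"
      using locally_integrable_ball[OF f, of x r] locally_integrable_ball[OF g, of x r]
      by (simp add: mean_on_def B scaleR_add_right)
    have "osc B (\<lambda>x. f x + g x) \<le> (\<integral>\<^sup>+x. ennreal (norm (f x - mean_on B f)) * indicator B x
        + ennreal (norm (g x - mean_on B g)) * indicator B x \<partial>lebesgue)"
      unfolding osc_def
    proof (rule nn_integral_mono)
      fix x
      have "norm (f x + g x - mean_on B (\<lambda>x. f x + g x))
          \<le> norm (f x - mean_on B f) + norm (g x - mean_on B g)"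
        unfolding mean using norm_triangle_ineq[of "f x - mean_on B f" "g x - mean_on B g"]
        by (simp add: algebra_simps)
      then show "ennreal (norm (f x + g x - mean_on B (\<lambda>x. f x + g x))) * indicator B x
          \<le> ennreal (norm (f x - mean_on B f)) * indicator B x
            + ennreal (norm (g x - mean_on B g)) * indicator B x"
        by (auto simp: indicator_def ennreal_plus[symmetric] simp del: ennreal_plus intro: ennreal_leI)
    qed
    also have "\<dots> = osc B f + osc B g"
      unfolding osc_def by (rule nn_integral_add) measurable
    finally have "osc B (\<lambda>x. f x + g x) / emeasure lebesgue B
        \<le> osc B f / emeasure lebesgue B + osc B g / emeasure lebesgue B"
      by (metis add_divide_distrib_ennreal divide_right_mono_ennreal)
    also have "\<dots> \<le> bmo_seminorm f + bmo_seminorm g"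
      unfolding bmo_seminorm_def osc_def using that by (intro add_mono SUP_upper) auto
    finally show ?thesis .
  qed
  then show ?thesis
    unfolding bmo_seminorm_def[of "\<lambda>x. f x + g x"] osc_def by (intro SUP_least) auto
qed

lemma locally_integrable_diff:
  assumes "f \<in> locally_integrable" "g \<in> locally_integrable"
  shows "(\<lambda>x. f x - g x) \<in> locally_integrable"
  using assms by (auto simp: locally_integrable_def)

lemma BMO_diff:
  assumes "f \<in> BMO" "g \<in> BMO"
  shows "(\<lambda>x. f x - g x) \<in> BMO"
proof -
  have f: "f \<in> locally_integrable" and g: "(\<lambda>x. - g x) \<in> locally_integrable"
    using assms by (auto simp: BMO_def locally_integrable_def set_integrable_def)
  have "bmo_seminorm (\<lambda>x. f x - g x) \<le> bmo_seminorm f + bmo_seminorm g"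
    using bmo_seminorm_add_le[OF f g] by (simp add: bmo_seminorm_minus)
  also have "\<dots> < \<infinity>"
    using assms by (auto simp: BMO_def)
  finally show ?thesis
    using assms by (auto simp: BMO_def intro: locally_integrable_diff)
qed

lemma bmo_norm_triangle:
  assumes "f \<in> BMO" "g \<in> BMO" "h \<in> BMO"
  shows "bmo_norm (\<lambda>x. f x - h x) \<le> bmo_norm (\<lambda>x. f x - g x) + bmo_norm (\<lambda>x. g x - h x)"
proof -
  \<comment> \<open>\<open>enn2real\<close> sends \<infinity> to 0, so the inequality of seminorms
    passes to real numbers only once both summands are known to be finite.\<close>
  have fg: "(\<lambda>x. f x - g x) \<in> BMO" and gh: "(\<lambda>x. g x - h x) \<in> BMO"
    using assms by (auto intro: BMO_diff)
  have "bmo_seminorm (\<lambda>x. (f x - g x) + (g x - h x))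
      \<le> bmo_seminorm (\<lambda>x. f x - g x) + bmo_seminorm (\<lambda>x. g x - h x)"
    using fg gh by (intro bmo_seminorm_add_le) (auto simp: BMO_def)
  then show ?thesis
    using fg gh unfolding bmo_norm_def
    by (simp add: BMO_def enn2real_plus[symmetric] enn2real_mono)
qed

section \<open>Local integrability and VMO under changes on null sets\<close>

lemma locally_integrable_cong_AE:
  assumes "f \<in> locally_integrable" "(f, g) \<in> ae_eq"
  shows "g \<in> locally_integrable"
  unfolding locally_integrable_def
proof (intro CollectI conjI allI impI)
  show "g \<in> borel_measurable lebesgue"
    using assms by (auto dest: ae_eqD)
  fix C :: "'a set" assume C: "compact C"
  have "set_integrable lebesgue C f = set_integrable lebesgue C g"
    using ae_eqD[OF assms(2)] C by (intro set_integrable_cong_AE) (auto intro: fmeasurableD lmeasurable_compact)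
  then show "set_integrable lebesgue C g"
    using assms(1) C by (auto simp: locally_integrable_def)
qed

text \<open>The same approximants from \<open>Cc\<close> serve both functions: subtracting one of
  them preserves agreement almost everywhere, hence the seminorm of the difference.\<close>

lemma VMO_cong_AE:
  assumes f: "f \<in> VMO" and fg: "(f, g) \<in> ae_eq"
  shows "g \<in> VMO"
proof -
  note ae = ae_eqD[OF fg]
  have "bmo_seminorm (\<lambda>x. g x - h x) = bmo_seminorm (\<lambda>x. f x - h x)" if "h \<in> Cc" for h
  proof (rule bmo_seminorm_cong_AE)
    have "h \<in> borel_measurable borel"
      using that by (auto simp: Cc_def intro: borel_measurable_continuous_onI)
    then have [measurable]: "h \<in> borel_measurable lebesgue"
      by (simp add: measurable_completion)
    show "(\<lambda>x. g x - h x) \<in> borel_measurable lebesgue" "(\<lambda>x. f x - h x) \<in> borel_measurable lebesgue"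
      using ae by auto
    show "AE x in lebesgue. g x - h x = f x - h x"
      using ae(3) by eventually_elim simp
  qed
  moreover have "g \<in> BMO"
    using f locally_integrable_cong_AE[OF _ fg] bmo_seminorm_cong_AE[OF ae]
    by (auto simp: VMO_def BMO_def)
  ultimately show ?thesis
    using f by (auto simp: VMO_def)
qed

section \<open>Essential support and extension by zero\<close>

lemma ess_support_cong_AE:
  assumes "AE x in lebesgue. f x = g x"
  shows "ess_support f = ess_support g"
proof -
  have "(AE x in lebesgue. x \<in> U \<longrightarrow> f x = 0) \<longleftrightarrow> (AE x in lebesgue. x \<in> U \<longrightarrow> g x = 0)" for U
    using assms by (intro AE_cong_simp eventually_subst) (auto elim!: eventually_mono)
  then show ?thesis
    by (simp add: ess_support_def)
qed

text \<open>The union defining the complement of \<open>ess_support f\<close> may be uncountable,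
  whereas null sets combine only countably; a countable subfamily with the same union closes the
  gap.\<close>

lemma AE_zero_outside_ess_support: "AE x in lebesgue. x \<notin> ess_support f \<longrightarrow> f x = 0"
proof -
  define \<U> where "\<U> = {U. open U \<and> (AE x in lebesgue. x \<in> U \<longrightarrow> f x = 0)}"
  obtain \<V> where \<V>: "\<V> \<subseteq> \<U>" "countable \<V>" "\<Union>\<V> = \<Union>\<U>"
    using Lindelof[of \<U>] by (auto simp: \<U>_def)
  have "AE x in lebesgue. \<forall>U\<in>\<V>. x \<in> U \<longrightarrow> f x = 0"
    using \<V> by (subst AE_ball_countable) (auto simp: \<U>_def)
  then show ?thesis
  proof eventually_elim
    case (elim x)
    then have "x \<in> \<Union>\<U> \<longrightarrow> f x = 0"
      unfolding \<V>(3)[symmetric] by blast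
    then show ?case
      unfolding ess_support_def \<U>_def by blast
  qed
qed

text \<open>The two functions can differ only off \<open>K\<close>, thus off the essential support,
  where \<open>f\<close> vanishes almost everywhere. Closedness of \<open>K\<close> makes the
  extension measurable.\<close>

lemma zero_extension_ae_eq:
  assumes f: "f \<in> borel_measurable lebesgue" and K: "closed K" and supp: "ess_support f \<subseteq> K"
  shows "(f, zero_extension K f) \<in> ae_eq"
proof -
  have "zero_extension K f \<in> borel_measurable lebesgue"
    unfolding zero_extension_def using f K by (intro measurable_If_set) auto
  moreover have "AE x in lebesgue. f x = zero_extension K f x"
    using AE_zero_outside_ess_support[of f]
    by eventually_elim (use supp in \<open>auto simp: zero_extension_def\<close>)
  ultimately show ?thesis
    using f by (simp add: ae_eq_def)
qed

section \<open>Minkowski's inequality for the Gagliardo norm\<close>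

text \<open>Used for the measurability of the inner Gagliardo integral as a function of the outer
  variable.\<close>

lemma sigma_finite_lebesgue: "sigma_finite_measure (lebesgue :: 'a::euclidean_space measure)"
proof
  let ?A = "range (\<lambda>n::nat. ball (0::'a) (real n))"
  have "\<exists>n::nat. norm x < real n" for x :: 'a
    by (rule reals_Archimedean2)
  then have "\<Union>?A = space lebesgue"
    by auto
  moreover have "emeasure lebesgue (ball (0::'a) (real n)) \<noteq> \<infinity>" for n
    using emeasure_lborel_ball_finite[of "0::'a" "real n"] by simp
  ultimately show "\<exists>A::'a set set. countable A \<and> A \<subseteq> sets lebesgue \<and> \<Union>A = space lebesgue \<and>
      (\<forall>a\<in>A. emeasure lebesgue a \<noteq> \<infinity>)"
    by (intro exI[of _ ?A]) auto
qed

interpretation lebesgue: sigma_finite_measure "lebesgue :: 'a::euclidean_space measure"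
  by (rule sigma_finite_lebesgue)

text \<open>Jensen's inequality for the \<open>p\<close>-th power: \<open>(u + v) / (a + b)\<close>
  is the convex combination of \<open>u / a\<close> and \<open>v / b\<close> with weights
  \<open>a / (a + b)\<close> and \<open>b / (a + b)\<close>. Keeping \<open>a\<close> and
  \<open>b\<close> free allows them to be set to norms later, which turns this into Minkowski's
  inequality.\<close>

lemma powr_add_le:
  fixes a b u v p :: real
  assumes "1 < p" "0 < a" "0 < b" "0 \<le> u" "0 \<le> v"
  shows "(u + v) powr p \<le> (a + b) powr (p - 1) * a powr (1 - p) * u powr p
    + (a + b) powr (p - 1) * b powr (1 - p) * v powr p"
proof -
  \<comment> \<open>Both coefficients are at least 1 because \<open>c\<close> is at most
    \<open>a + b\<close>. This settles the case where \<open>u\<close> or \<open>v\<close> is 0, as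
    convexity is applied on the open half-line.\<close>
  have *: "1 \<le> (a + b) powr (p - 1) * c powr (1 - p)" if "c = a \<or> c = b" for c
  proof -
    have "c powr (p - 1) * c powr (1 - p) \<le> (a + b) powr (p - 1) * c powr (1 - p)"
      using that assms by (intro mult_right_mono powr_mono2) auto
    moreover have "c powr (p - 1) * c powr (1 - p) = 1"
      using that assms by (auto simp: powr_add[symmetric])
    ultimately show ?thesis by simp
  qed
  show ?thesis
  proof (cases "u = 0 \<or> v = 0")
    case True
    then show ?thesis
      using assms mult_right_mono[OF *[of a], of "u powr p"] mult_right_mono[OF *[of b], of "v powr p"]
      by auto
  next
    case False
    then have pos: "0 < u" "0 < v"
      using assms by auto
    define t where "t = b / (a + b)"
    have t: "0 \<le> t" "t \<le> 1" "1 - t = a / (a + b)"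
      using assms by (auto simp: t_def field_simps)
    have conv: "convex_on {0<..} (\<lambda>x::real. x powr p)"
      using assms by (intro powr_convex) auto
    have "((1 - t) * (u / a) + t * (v / b)) powr p \<le> (1 - t) * (u / a) powr p + t * (v / b) powr p"
      using convex_onD[OF conv t(1,2), of "u / a" "v / b"] pos assms by simp
    moreover have "(1 - t) * (u / a) + t * (v / b) = (u + v) / (a + b)"
      unfolding t(3) using assms by (simp add: t_def add_divide_distrib)
    ultimately have "((u + v) / (a + b)) powr p
        \<le> a / (a + b) * (u / a) powr p + b / (a + b) * (v / b) powr p"
      unfolding t(3) by (simp add: t_def)
    then have "(a + b) powr p * ((u + v) / (a + b)) powr p
        \<le> (a + b) powr p * (a / (a + b) * (u / a) powr p + b / (a + b) * (v / b) powr p)"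
      by (rule mult_left_mono) simp
    moreover have "(a + b) powr p * ((u + v) / (a + b)) powr p = (u + v) powr p"
      using assms pos by (simp add: powr_mult[symmetric])
    moreover have "(a + b) powr p * (c / (a + b) * (w / c) powr p)
        = (a + b) powr (p - 1) * c powr (1 - p) * w powr p" if "0 < c" "0 < w" for c w
      using assms that by (simp add: powr_diff powr_divide field_simps)
    ultimately show ?thesis
      using assms pos by (simp add: distrib_left)
  qed
qed

text \<open>The \<open>p\<close>-th power of the Gagliardo seminorm, separated from the Lebesgue
  part of \<open>gagliardo_power\<close>.\<close>

definition gagliardo_energy ::
    "real \<Rightarrow> real \<Rightarrow> ('a::euclidean_space \<Rightarrow> 'b::euclidean_space) \<Rightarrow> ennreal" where
  "gagliardo_energy s p f = (\<integral>\<^sup>+x. (\<integral>\<^sup>+y.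
     ennreal (norm (f x - f y) powr p / norm (x - y) powr (real DIM('a) + s * p)) \<partial>lebesgue) \<partial>lebesgue)"

lemma gagliardo_power_eq:
  "gagliardo_power s p f = (\<integral>\<^sup>+x. ennreal (norm (f x) powr p) \<partial>lebesgue) + gagliardo_energy s p f"
  by (simp add: gagliardo_power_def gagliardo_energy_def)

lemma gagliardo_integrand_measurable:
  fixes f :: "'a::euclidean_space \<Rightarrow> 'b::euclidean_space"
  assumes [measurable]: "f \<in> borel_measurable lebesgue"
  shows "(\<lambda>(x, y). ennreal (norm (f x - f y) powr p / norm (x - y) powr q))
    \<in> borel_measurable (lebesgue \<Otimes>\<^sub>M lebesgue)"
proof -
  \<comment> \<open>The projections map into \<open>lebesgue\<close>; composing with the identity
    brings them to the Borel sigma-algebra, where subtraction is measurable.\<close>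
  have [measurable]: "(\<lambda>x::'a. x) \<in> borel_measurable lebesgue"
    by (rule measurable_completion) simp
  have "(\<lambda>z::'a \<times> 'a. fst z - snd z) \<in> borel_measurable (lebesgue \<Otimes>\<^sub>M lebesgue)"
    by (intro borel_measurable_diff measurable_compose[OF measurable_fst]
        measurable_compose[OF measurable_snd]) measurable
  then show ?thesis
    by (simp add: case_prod_beta')
qed

text \<open>The constants in \<open>powr_add_le\<close> do not depend on the point, so the
  inequality integrates with the same constants in the Lebesgue part and in the double integral, and
  the two results add up.\<close>

lemma gagliardo_power_add_le:
  fixes f g :: "'a::euclidean_space \<Rightarrow> 'b::euclidean_space"
  assumes p: "1 < p" and a: "0 < a" and b: "0 < b"
    and f[measurable]: "f \<in> borel_measurable lebesgue"
    and g[measurable]: "g \<in> borel_measurable lebesgue"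
  shows "gagliardo_power s p (\<lambda>x. f x + g x)
    \<le> ennreal ((a + b) powr (p - 1) * a powr (1 - p)) * gagliardo_power s p f
      + ennreal ((a + b) powr (p - 1) * b powr (1 - p)) * gagliardo_power s p g"
proof -
  define \<alpha> where "\<alpha> = (a + b) powr (p - 1) * a powr (1 - p)"
  define \<beta> where "\<beta> = (a + b) powr (p - 1) * b powr (1 - p)"
  define q where "q = real DIM('a) + s * p"
  have nonneg: "0 \<le> \<alpha>" "0 \<le> \<beta>"
    by (auto simp: \<alpha>_def \<beta>_def)
  have le: "norm (u + v) powr p \<le> \<alpha> * norm u powr p + \<beta> * norm v powr p" for u v :: 'b
  proof -
    have "norm (u + v) powr p \<le> (norm u + norm v) powr p"
      using p by (intro powr_mono2 norm_triangle_ineq) auto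
    also have "\<dots> \<le> \<alpha> * norm u powr p + \<beta> * norm v powr p"
      unfolding \<alpha>_def \<beta>_def using p a b by (intro powr_add_le) auto
    finally show ?thesis .
  qed
  \<comment> \<open>The case \<open>w = 0\<close> occurs on the diagonal, where every quotient is
    0.\<close>
  have le_div: "norm (u + v) powr p / w \<le> \<alpha> * (norm u powr p / w) + \<beta> * (norm v powr p / w)"
    if "0 \<le> w" for u v :: 'b and w
    using divide_right_mono[OF le that, of u v] by (simp add: add_divide_distrib)
  have ennreal_split: "ennreal (\<alpha> * u + \<beta> * v) = ennreal \<alpha> * ennreal u + ennreal \<beta> * ennreal v"
    if "0 \<le> u" "0 \<le> v" for u v
    using nonneg that by (simp add: ennreal_mult)
  have "(\<integral>\<^sup>+x. ennreal (norm (f x + g x) powr p) \<partial>lebesgue)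
      \<le> (\<integral>\<^sup>+x. ennreal \<alpha> * ennreal (norm (f x) powr p) + ennreal \<beta> * ennreal (norm (g x) powr p) \<partial>lebesgue)"
    by (intro nn_integral_mono) (simp add: ennreal_split[symmetric] ennreal_leI le)
  also have "\<dots> = ennreal \<alpha> * (\<integral>\<^sup>+x. ennreal (norm (f x) powr p) \<partial>lebesgue)
      + ennreal \<beta> * (\<integral>\<^sup>+x. ennreal (norm (g x) powr p) \<partial>lebesgue)"
    by (subst nn_integral_add) (auto simp: nn_integral_cmult)
  finally have Lp: "(\<integral>\<^sup>+x. ennreal (norm (f x + g x) powr p) \<partial>lebesgue) \<le> \<dots>" .

  define I where "I h x y = ennreal (norm (h x - h y) powr p / norm (x - y) powr q)"
    for h :: "'a \<Rightarrow> 'b" and x y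
  have energy: "gagliardo_energy s p h = (\<integral>\<^sup>+x. (\<integral>\<^sup>+y. I h x y \<partial>lebesgue) \<partial>lebesgue)" for h :: "'a \<Rightarrow> 'b"
    by (simp add: gagliardo_energy_def I_def q_def)
  have meas_pair[measurable]: "case_prod (I h) \<in> borel_measurable (lebesgue \<Otimes>\<^sub>M lebesgue)"
    if "h \<in> borel_measurable lebesgue" for h
    using gagliardo_integrand_measurable[OF that] by (simp add: I_def case_prod_beta')
  have meas_inner: "I h x \<in> borel_measurable lebesgue" if "h \<in> borel_measurable lebesgue" for h x
    using measurable_Pair2[OF meas_pair[OF that], of x] by simp
  have meas_outer: "(\<lambda>x. \<integral>\<^sup>+y. I h x y \<partial>lebesgue) \<in> borel_measurable lebesgue"
    if "h \<in> borel_measurable lebesgue" for h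
    using meas_pair[OF that] by (rule lebesgue.borel_measurable_nn_integral)
  have "I (\<lambda>x. f x + g x) x y \<le> ennreal \<alpha> * I f x y + ennreal \<beta> * I g x y" for x y
    using le_div[of "norm (x - y) powr q" "f x - f y" "g x - g y"]
    by (simp add: I_def ennreal_split[symmetric] ennreal_leI add_diff_add)
  then have "gagliardo_energy s p (\<lambda>x. f x + g x)
      \<le> (\<integral>\<^sup>+x. (\<integral>\<^sup>+y. ennreal \<alpha> * I f x y + ennreal \<beta> * I g x y \<partial>lebesgue) \<partial>lebesgue)"
    unfolding energy by (intro nn_integral_mono)
  also have "\<dots> = (\<integral>\<^sup>+x. ennreal \<alpha> * (\<integral>\<^sup>+y. I f x y \<partial>lebesgue)
      + ennreal \<beta> * (\<integral>\<^sup>+y. I g x y \<partial>lebesgue) \<partial>lebesgue)"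
    using meas_inner[OF f] meas_inner[OF g] by (simp add: nn_integral_add nn_integral_cmult)
  also have "\<dots> = ennreal \<alpha> * gagliardo_energy s p f + ennreal \<beta> * gagliardo_energy s p g"
    unfolding energy using meas_outer[OF f] meas_outer[OF g]
    by (simp add: nn_integral_add nn_integral_cmult)
  finally have E: "gagliardo_energy s p (\<lambda>x. f x + g x) \<le> \<dots>" .
  show ?thesis
    using add_mono[OF Lp E] unfolding gagliardo_power_eq \<alpha>_def[symmetric] \<beta>_def[symmetric]
    by (simp add: distrib_left ac_simps)
qed

lemma gagliardo_power_zero: "gagliardo_power s p (\<lambda>x. 0) = 0"
  by (simp add: gagliardo_power_def)

lemma gagliardo_power_minus: "gagliardo_power s p (\<lambda>x. - f x) = gagliardo_power s p f"
proof -
  have "norm (- f x - - f y) = norm (f x - f y)" for x y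
    by (simp add: norm_minus_commute)
  then show ?thesis
    by (simp only: gagliardo_power_def norm_minus_cancel)
qed

lemma gagliardo_power_cong_AE:
  assumes ae: "AE x in lebesgue. f x = g x"
  shows "gagliardo_power s p f = gagliardo_power s p g"
proof -
  have "(\<integral>\<^sup>+x. ennreal (norm (f x) powr p) \<partial>lebesgue) = (\<integral>\<^sup>+x. ennreal (norm (g x) powr p) \<partial>lebesgue)"
    using ae by (intro nn_integral_cong_AE) auto
  moreover have "gagliardo_energy s p f = gagliardo_energy s p g"
    unfolding gagliardo_energy_def
  \<comment> \<open>For almost every \<open>x\<close> the functions agree at \<open>x\<close>; with
    such an \<open>x\<close> fixed, the inner integrands agree for almost every
    \<open>y\<close>.\<close>
  proof (rule nn_integral_cong_AE, use ae in eventually_elim)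
    case (elim x)
    show ?case
      by (rule nn_integral_cong_AE, use ae in eventually_elim) (simp add: elim)
  qed
  ultimately show ?thesis
    by (simp add: gagliardo_power_eq)
qed

section \<open>The Sobolev--Slobodeckij norm: triangle inequality, separation and symmetry\<close>

lemma Wsp_norm_nonneg: "0 \<le> Wsp_norm s p f"
  by (simp add: Wsp_norm_def)

lemma Wsp_diff:
  assumes p: "1 < p" and f: "f \<in> Wsp s p" and g: "g \<in> Wsp s p"
  shows "(\<lambda>x. f x - g x) \<in> Wsp s p"
proof -
  have meas: "f \<in> borel_measurable lebesgue" "(\<lambda>x. - g x) \<in> borel_measurable lebesgue"
    using f g by (auto simp: Wsp_def)
  \<comment> \<open>Only finiteness matters here, so the weights \<open>a = b = 1\<close>
    suffice.\<close>
  have "gagliardo_power s p (\<lambda>x. f x - g x)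
      \<le> ennreal ((1 + 1) powr (p - 1) * 1 powr (1 - p)) * gagliardo_power s p f
        + ennreal ((1 + 1) powr (p - 1) * 1 powr (1 - p)) * gagliardo_power s p g"
    using gagliardo_power_add_le[OF p zero_less_one zero_less_one meas, of s]
    by (simp add: gagliardo_power_minus)
  also have "\<dots> < \<infinity>"
    using f g by (auto simp: Wsp_def ennreal_mult_less_top)
  finally show ?thesis
    using f g by (auto simp: Wsp_def)
qed

text \<open>With \<open>a\<close> and \<open>b\<close> essentially the two norms, the bound of
  \<open>gagliardo_power_add_le\<close> collapses to \<open>(a + b) powr p\<close>, and a
  \<open>p\<close>-th root gives the claim.\<close>

lemma Wsp_norm_add_le:
  assumes p: "1 < p" and f: "f \<in> Wsp s p" and g: "g \<in> Wsp s p"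
  shows "Wsp_norm s p (\<lambda>x. f x + g x) \<le> Wsp_norm s p f + Wsp_norm s p g"
proof (rule field_le_epsilon)
  fix e :: real assume e: "0 < e"
  have power_le: "gagliardo_power s p h \<le> ennreal ((Wsp_norm s p h + e / 2) powr p)"
    if "h \<in> Wsp s p" for h :: "'a \<Rightarrow> 'b"
  proof -
    have "enn2real (gagliardo_power s p h) = Wsp_norm s p h powr p"
      using p by (simp add: Wsp_norm_def powr_powr)
    also have "\<dots> \<le> (Wsp_norm s p h + e / 2) powr p"
      using p e by (intro powr_mono2) (auto simp: Wsp_norm_nonneg)
    finally have "ennreal (enn2real (gagliardo_power s p h)) \<le> ennreal ((Wsp_norm s p h + e / 2) powr p)"
      by (rule ennreal_leI)
    moreover have "ennreal (enn2real (gagliardo_power s p h)) = gagliardo_power s p h"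
      using that by (simp add: Wsp_def)
    ultimately show ?thesis
      by simp
  qed
  \<comment> \<open>The shift by \<open>e / 2\<close> keeps the weights positive even when a norm is
    0; together the two shifts cost exactly \<open>e\<close>.\<close>
  define a where "a = Wsp_norm s p f + e / 2"
  define b where "b = Wsp_norm s p g + e / 2"
  have ab: "0 < a" "0 < b"
    using e Wsp_norm_nonneg[of s p f] Wsp_norm_nonneg[of s p g] by (auto simp: a_def b_def)
  have cancel: "c powr (1 - p) * c powr p = c" if "0 < c" for c
    using that by (simp add: powr_add[symmetric])
  have "gagliardo_power s p (\<lambda>x. f x + g x)
      \<le> ennreal ((a + b) powr (p - 1) * a powr (1 - p)) * gagliardo_power s p f
        + ennreal ((a + b) powr (p - 1) * b powr (1 - p)) * gagliardo_power s p g"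
    using f g by (intro gagliardo_power_add_le p ab) (auto simp: Wsp_def)
  also have "\<dots> \<le> ennreal ((a + b) powr (p - 1) * a powr (1 - p)) * ennreal (a powr p)
        + ennreal ((a + b) powr (p - 1) * b powr (1 - p)) * ennreal (b powr p)"
    using power_le[OF f] power_le[OF g] unfolding a_def b_def by (intro add_mono mult_left_mono) auto
  also have "\<dots> = ennreal ((a + b) powr (p - 1) * (a powr (1 - p) * a powr p)
        + (a + b) powr (p - 1) * (b powr (1 - p) * b powr p))"
    using ab by (simp add: ennreal_mult[symmetric] ennreal_plus[symmetric] mult.assoc del: ennreal_plus)
  also have "(a + b) powr (p - 1) * (a powr (1 - p) * a powr p)
        + (a + b) powr (p - 1) * (b powr (1 - p) * b powr p) = (a + b) powr p"
    unfolding cancel[OF ab(1)] cancel[OF ab(2)] using ab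
    by (simp add: distrib_left[symmetric] add_divide_distrib[symmetric] powr_diff)
  finally have "enn2real (gagliardo_power s p (\<lambda>x. f x + g x)) \<le> (a + b) powr p"
    by (intro enn2real_leI) auto
  then have "Wsp_norm s p (\<lambda>x. f x + g x) \<le> ((a + b) powr p) powr (1 / p)"
    unfolding Wsp_norm_def using p by (intro powr_mono2) auto
  also have "\<dots> = Wsp_norm s p f + Wsp_norm s p g + e"
    using p ab by (simp add: powr_powr a_def b_def)
  finally show "Wsp_norm s p (\<lambda>x. f x + g x) \<le> Wsp_norm s p f + Wsp_norm s p g + e" .
qed

lemma Wsp_norm_triangle:
  assumes p: "1 < p" and "f \<in> Wsp s p" "g \<in> Wsp s p" "h \<in> Wsp s p"
  shows "Wsp_norm s p (\<lambda>x. f x - h x) \<le> Wsp_norm s p (\<lambda>x. f x - g x) + Wsp_norm s p (\<lambda>x. g x - h x)"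
  using Wsp_norm_add_le[OF p Wsp_diff[OF p assms(2,3)] Wsp_diff[OF p assms(3,4)]] by simp

lemma AE_eq_if_Wsp_norm_diff_eq_0:
  assumes p: "1 < p" and f: "f \<in> Wsp s p" and g: "g \<in> Wsp s p"
    and 0: "Wsp_norm s p (\<lambda>x. f x - g x) = 0"
  shows "AE x in lebesgue. f x = g x"
proof -
  have [measurable]: "f \<in> borel_measurable lebesgue" "g \<in> borel_measurable lebesgue"
    using f g by (auto simp: Wsp_def)
  \<comment> \<open>A vanishing \<open>enn2real\<close> could also come from the value \<infinity>,
    which is excluded first.\<close>
  have "gagliardo_power s p (\<lambda>x. f x - g x) < \<infinity>"
    using Wsp_diff[OF p f g] by (simp add: Wsp_def)
  then have "gagliardo_power s p (\<lambda>x. f x - g x) = 0"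
    using 0 by (auto simp: Wsp_norm_def enn2real_eq_0_iff)
  then have "(\<integral>\<^sup>+x. ennreal (norm (f x - g x) powr p) \<partial>lebesgue) = 0"
    by (simp add: gagliardo_power_eq)
  then have "AE x in lebesgue. ennreal (norm (f x - g x) powr p) = 0"
    by (subst (asm) nn_integral_0_iff_AE) auto
  then show ?thesis
    by eventually_elim (simp add: ennreal_eq_0_iff)
qed

lemma Wsp_norm_zero: "1 < p \<Longrightarrow> Wsp_norm s p (\<lambda>x. 0) = 0"
  by (simp add: Wsp_norm_def gagliardo_power_zero)

lemma Wsp_norm_commute: "Wsp_norm s p (\<lambda>x. f x - g x) = Wsp_norm s p (\<lambda>x. g x - f x)"
  using gagliardo_power_minus[of s p "\<lambda>x. f x - g x"] by (simp add: Wsp_norm_def)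

lemma bmo_norm_commute: "bmo_norm (\<lambda>x. f x - g x) = bmo_norm (\<lambda>x. g x - f x)"
  using bmo_seminorm_minus[of "\<lambda>x. f x - g x"] by (simp add: bmo_norm_def)

section \<open>The metric spaces of classes\<close>

lemma ae_saturated_Wsp: "ae_saturated (Wsp s p)"
  unfolding ae_saturated_def
proof (intro conjI allI impI)
  show "Wsp s p \<subseteq> borel_measurable lebesgue"
    by (auto simp: Wsp_def)
  fix f g :: "'a \<Rightarrow> 'b"
  assume "f \<in> Wsp s p" and fg: "(f, g) \<in> ae_eq"
  then show "g \<in> Wsp s p"
    using ae_eqD[OF fg] gagliardo_power_cong_AE[of f g s p] by (simp add: Wsp_def)
qed

lemma ae_saturated_VMO_Wsp: "ae_saturated (VMO_Wsp K s p)"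
  unfolding ae_saturated_def
proof (intro conjI allI impI)
  show "VMO_Wsp K s p \<subseteq> borel_measurable lebesgue"
    by (auto simp: VMO_Wsp_def Wsp_def)
  fix f g :: "'a \<Rightarrow> 'b"
  assume f: "f \<in> VMO_Wsp K s p" and fg: "(f, g) \<in> ae_eq"
  then have "g \<in> VMO" "g \<in> Wsp s p"
    using VMO_cong_AE[OF _ fg] ae_saturatedD(2)[OF ae_saturated_Wsp _ fg]
    by (auto simp: VMO_Wsp_def VMO_supported_def)
  then show "g \<in> VMO_Wsp K s p"
    using f ess_support_cong_AE[OF ae_eqD(3)[OF fg]] by (auto simp: VMO_Wsp_def VMO_supported_def)
qed

lemma Metric_space_Wsp:
  assumes "1 < p"
  shows "Metric_space (Wsp s p // ae_eq) (class_dist (Wsp_norm s p))"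
  by (rule Metric_space_quotient)
    (use assms in \<open>auto intro: ae_saturated_Wsp Wsp_norm_nonneg Wsp_norm_zero Wsp_norm_commute
      AE_eq_if_Wsp_norm_diff_eq_0 Wsp_norm_triangle\<close>)

lemma Wsp_norm_le_graph_norm: "Wsp_norm s p f \<le> graph_norm s p f"
  by (simp add: graph_norm_def bmo_norm_def)

lemma Metric_space_VMO_Wsp:
  assumes p: "1 < p"
  shows "Metric_space (VMO_Wsp K s p // ae_eq) (class_dist (graph_norm s p))"
proof (rule Metric_space_quotient)
  show "ae_saturated (VMO_Wsp K s p)"
    by (rule ae_saturated_VMO_Wsp)
  show "0 \<le> graph_norm s p f" for f :: "'a \<Rightarrow> 'b"
    using Wsp_norm_nonneg Wsp_norm_le_graph_norm by (rule order_trans)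
  show "graph_norm s p (\<lambda>x. 0) = 0"
    using p by (simp add: graph_norm_def bmo_norm_def bmo_seminorm_zero Wsp_norm_zero)
  show "graph_norm s p (\<lambda>x. f x - g x) = graph_norm s p (\<lambda>x. g x - f x)" for f g :: "'a \<Rightarrow> 'b"
    unfolding graph_norm_def by (intro arg_cong2[where f = "(+)"] bmo_norm_commute Wsp_norm_commute)
  fix f g :: "'a \<Rightarrow> 'b"
  assume f: "f \<in> VMO_Wsp K s p" and g: "g \<in> VMO_Wsp K s p"
  \<comment> \<open>The BMO part vanishes on constants, so separation is drawn from the Sobolev
    part.\<close>
  show "AE x in lebesgue. f x = g x" if "graph_norm s p (\<lambda>x. f x - g x) = 0"
  proof (rule AE_eq_if_Wsp_norm_diff_eq_0[OF p])
    show "Wsp_norm s p (\<lambda>x. f x - g x) = 0"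
      using that Wsp_norm_le_graph_norm[of s p "\<lambda>x. f x - g x"]
      by (intro antisym Wsp_norm_nonneg) simp
  qed (use f g in \<open>auto simp: VMO_Wsp_def\<close>)
  fix h :: "'a \<Rightarrow> 'b"
  assume h: "h \<in> VMO_Wsp K s p"
  show "graph_norm s p (\<lambda>x. f x - h x) \<le> graph_norm s p (\<lambda>x. f x - g x) + graph_norm s p (\<lambda>x. g x - h x)"
    using f g h bmo_norm_triangle[of f g h] Wsp_norm_triangle[OF p, of f s g h]
    by (simp add: graph_norm_def VMO_Wsp_def VMO_supported_def VMO_def)
qed

theorem proposition31:
  fixes s p :: real
    and K :: "'a::euclidean_space set"
  assumes "0 < s" "s < 1" "1 < p"
    and "compact K"
  shows "(VMO_Wsp K s p :: ('a \<Rightarrow> 'b::euclidean_space) set) // ae_eq \<subseteq> Wsp s p // ae_eq \<and>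
    continuous_map
      (norm_topology (VMO_Wsp K s p :: ('a \<Rightarrow> 'b) set) (graph_norm s p))
      (norm_topology (Wsp s p) (Wsp_norm s p)) (\<lambda>F. F) \<and>
    (\<forall>F \<in> (VMO_Wsp K s p :: ('a \<Rightarrow> 'b) set) // ae_eq. \<forall>f \<in> F.
       ae_eq `` {zero_extension K f} = F)"
proof (intro conjI ballI)
  let ?X = "VMO_Wsp K s p :: ('a \<Rightarrow> 'b) set"
  show sub: "?X // ae_eq \<subseteq> Wsp s p // ae_eq"
    by (auto simp: quotient_def VMO_Wsp_def)
  interpret X: Metric_space "?X // ae_eq" "class_dist (graph_norm s p)"
    using assms by (intro Metric_space_VMO_Wsp)
  interpret W: Metric_space "(Wsp s p :: ('a \<Rightarrow> 'b) set) // ae_eq" "class_dist (Wsp_norm s p)"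
    using assms by (intro Metric_space_Wsp)
  show "continuous_map (norm_topology ?X (graph_norm s p)) (norm_topology (Wsp s p) (Wsp_norm s p)) (\<lambda>F. F)"
    unfolding norm_topology_def W.continuous_map_to_metric X.topspace_mtopology
  proof (intro ballI allI impI)
    fix F and e :: real
    assume F: "F \<in> ?X // ae_eq" and e: "0 < e"
    have "G \<in> W.mball F e" if "G \<in> X.mball F e" for G
    proof -
      \<comment> \<open>\<open>class_dist\<close> chooses the representatives from the classes
        alone, so both distances evaluate the same difference and the domination of norms applies
        directly. Hence balls of equal radius are nested.\<close>
      have "class_dist (Wsp_norm s p) F G \<le> class_dist (graph_norm s p) F G"
        unfolding class_dist_def by (rule Wsp_norm_le_graph_norm)
      then show ?thesis
        using that sub by auto
    qed
    then show "\<exists>U. openin X.mtopology U \<and> F \<in> U \<and> (\<forall>G\<in>U. G \<in> W.mball F e)"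
      using F e by (intro exI[of _ "X.mball F e"]) auto
  qed
  fix F f
  assume F: "F \<in> ?X // ae_eq" and f: "f \<in> F"
  obtain f0 where f0: "f0 \<in> ?X" "F = ae_eq `` {f0}"
    using F by (auto elim: quotientE)
  then have f0f: "(f0, f) \<in> ae_eq"
    using f by simp
  \<comment> \<open>The representative \<open>f\<close> is arbitrary; saturation gives it the
    measurability and the support condition that the extension lemma asks for.\<close>
  then have "f \<in> ?X"
    by (rule ae_saturatedD(2)[OF ae_saturated_VMO_Wsp f0(1)])
  then have "(f, zero_extension K f) \<in> ae_eq"
    using assms(4) by (intro zero_extension_ae_eq)
      (auto simp: VMO_Wsp_def VMO_supported_def Wsp_def compact_imp_closed)
  then show "ae_eq `` {zero_extension K f} = F"
    using equiv_class_eq[OF equiv_ae_eq] f0f f0(2) by metis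
qed

end
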